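(* Let $\mathcal{Q}$ be a conjugate-invariant algebraically closed subfield of $\mathbb{C}$. Every real rational map which is definable over $\mathcal{Q}$ is also definable over $\mathbb{R}\cap\mathcal{Q}$.
   Context: Rational maps are complex rational maps of degree $d\ge 2$. Two of them, $\phi$ and $\psi$, are equivalent if $\psi=T\circ\phi\circ T^{-1}$ for some $T\in\mathrm{PSL}_2(\mathbb{C})$. A rational map is definable over a subfield $K\subset\mathbb{C}$ if it is equivalent to a rational map with coefficients in $K$. A rational map is real if it is equivalent to one with real coefficients (equivalently, it commutes with a reflection, i.e. an antiholomorphic involution of $\widehat{\mathbb{C}}$ with fixed points). A subfield of $\mathbb{C}$ is conjugate-invariant if it is invariant under complex conjugation. *)

theory Defs
  imports Complex_Main "HOL-Computational_Algebra.Computational_Algebra"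
begin

text \<open>
  The Riemann sphere is \<^typ>\<open>complex option\<close>, with \<^term>\<open>None\<close> as the point at infinity
  (the convention of \<open>Alexandroff_extension\<close> in the library).
\<close>

type_synonym riemann_sphere = "complex option"

text \<open>
  The self-map \<open>P/Q\<close> of the sphere. At infinity, with \<open>n = max (degree P) (degree Q)\<close>, its value is
  the ratio of the coefficients of \<open>P\<close> and \<open>Q\<close> in degree \<open>n\<close>. The definition is only meaningful
  for coprime \<open>P\<close> and \<open>Q\<close>.
\<close>

definition ratmap :: "complex poly \<Rightarrow> complex poly \<Rightarrow> riemann_sphere \<Rightarrow> riemann_sphere" where
  "ratmap P Q x =
     (case x of
        Some z \<Rightarrow> if poly Q z = 0 then None else Some (poly P z / poly Q z)
      | None \<Rightarrow>
          let n = max (degree P) (degree Q)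
          in if coeff Q n = 0 then None else Some (coeff P n / coeff Q n))"

text \<open>
  The bound on the degree is part of the notion of a rational map here. Taking \<open>P\<close> and \<open>Q\<close> coprime
  is no restriction on the coefficients: over a field \<open>K\<close>, common factors can be cancelled within \<open>K\<close>.
\<close>

definition rational_map_over :: "complex set \<Rightarrow> (riemann_sphere \<Rightarrow> riemann_sphere) \<Rightarrow> bool" where
  "rational_map_over K \<phi> \<longleftrightarrow>
     (\<exists>P Q. (\<forall>i. coeff P i \<in> K) \<and> (\<forall>i. coeff Q i \<in> K) \<and> coprime P Q \<and>
            max (degree P) (degree Q) \<ge> 2 \<and> \<phi> = ratmap P Q)"

abbreviation rational_map :: "(riemann_sphere \<Rightarrow> riemann_sphere) \<Rightarrow> bool" where
  "rational_map \<equiv> rational_map_over UNIV"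

definition moebius ::
    "complex \<Rightarrow> complex \<Rightarrow> complex \<Rightarrow> complex \<Rightarrow> riemann_sphere \<Rightarrow> riemann_sphere" where
  "moebius a b c d = ratmap [:b, a:] [:d, c:]"

text \<open>The group \<open>PSL(2, \<complex>)\<close>, identified with its image in the self-maps of the sphere.\<close>

definition PSL2C :: "(riemann_sphere \<Rightarrow> riemann_sphere) set" where
  "PSL2C = {moebius a b c d | a b c d. a * d - b * c = 1}"

lemma moebius_None:
  assumes "a * d - b * c = 1"
  shows "moebius a b c d None = (if c = 0 then None else Some (a / c))"
  using assms by (auto simp: moebius_def ratmap_def Let_def)

lemma moebius_Some:
  "moebius a b c d (Some z) =
     (if c * z + d = 0 then None else Some ((a * z + b) / (c * z + d)))"
  by (simp add: moebius_def ratmap_def algebra_simps)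

lemma moebius_inverse:
  assumes det: "a * d - b * c = 1"
  shows "moebius d (- b) (- c) a (moebius a b c d x) = x"
proof -
  have det': "d * a - (- b) * (- c) = 1"
    using det by (simp add: algebra_simps)
  show ?thesis
  proof (cases x)
    case None
    show ?thesis
    proof (cases "c = 0")
      case True
      then show ?thesis
        using None moebius_None[OF det] moebius_None[OF det'] by simp
    next
      case False
      then show ?thesis
        unfolding None moebius_None[OF det] by (simp add: moebius_Some)
    qed
  next
    case (Some z)
    show ?thesis
    proof (cases "c * z + d = 0")
      case True
      have "c \<noteq> 0"
        using True det by auto
      moreover have "d = - c * z"
        using True by (simp add: add_eq_0_iff)
      ultimately have "moebius d (- b) (- c) a None = Some z"
        unfolding moebius_None[OF det'] by simp
      then show ?thesis
        using Some True by (simp add: moebius_Some)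
    next
      case False
      define w where "w = (a * z + b) / (c * z + d)"
      have 1: "- c * w + a = 1 / (c * z + d)"
        using False det by (simp add: w_def field_simps)
      have "d * w - b = (d * (a * z + b) - b * (c * z + d)) / (c * z + d)"
        using False by (simp add: w_def diff_divide_distrib)
      also have "d * (a * z + b) - b * (c * z + d) = (a * d - b * c) * z"
        by (simp add: algebra_simps)
      finally have 2: "d * w + (- b) = z / (c * z + d)"
        using det by simp
      have "moebius d (- b) (- c) a (Some w) = Some z"
        unfolding moebius_Some 1 2 using False by simp
      then show ?thesis
        using Some False by (simp add: moebius_Some w_def)
    qed
  qed
qed

lemma bij_PSL2C:
  assumes "T \<in> PSL2C"
  shows "bij T"
proof -
  obtain a b c d where T: "T = moebius a b c d" and det: "a * d - b * c = 1"
    using assms by (auto simp: PSL2C_def)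
  have det': "d * a - (- b) * (- c) = 1"
    using det by (simp add: algebra_simps)
  show ?thesis
    unfolding T
    using moebius_inverse[OF det] moebius_inverse[OF det']
    by (intro o_bij[of "moebius d (- b) (- c) a"]) (simp_all add: fun_eq_iff)
qed

definition equivalent ::
    "(riemann_sphere \<Rightarrow> riemann_sphere) \<Rightarrow> (riemann_sphere \<Rightarrow> riemann_sphere) \<Rightarrow> bool" where
  "equivalent \<phi> \<psi> \<longleftrightarrow> (\<exists>T\<in>PSL2C. \<psi> = T \<circ> \<phi> \<circ> inv T)"

definition definable_over :: "(riemann_sphere \<Rightarrow> riemann_sphere) \<Rightarrow> complex set \<Rightarrow> bool" where
  "definable_over \<phi> K \<longleftrightarrow> (\<exists>\<psi>. rational_map_over K \<psi> \<and> equivalent \<phi> \<psi>)"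

definition real_rational_map :: "(riemann_sphere \<Rightarrow> riemann_sphere) \<Rightarrow> bool" where
  "real_rational_map \<phi> \<longleftrightarrow> rational_map \<phi> \<and> definable_over \<phi> \<real>"

definition complex_subfield :: "complex set \<Rightarrow> bool" where
  "complex_subfield K \<longleftrightarrow>
     0 \<in> K \<and> 1 \<in> K \<and>
     (\<forall>x\<in>K. \<forall>y\<in>K. x + y \<in> K \<and> x * y \<in> K) \<and>
     (\<forall>x\<in>K. - x \<in> K \<and> inverse x \<in> K)"

definition alg_closed_subfield :: "complex set \<Rightarrow> bool" where
  "alg_closed_subfield K \<longleftrightarrow>
     complex_subfield K \<and>
     (\<forall>p. (\<forall>i. coeff p i \<in> K) \<and> degree p > 0 \<longrightarrow> (\<exists>x\<in>K. poly p x = 0))"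

definition conjugate_invariant :: "complex set \<Rightarrow> bool" where
  "conjugate_invariant K \<longleftrightarrow> cnj ` K = K"

end

theory Submission
  imports Defs "HOL-Computational_Algebra.Field_as_Ring"
begin

text \<open>
  Let \<open>S\<close> be a map over \<open>\<Q>\<close> equivalent to \<open>\<phi>\<close>, and let the Moebius transformation \<open>T\<close> conjugate \<open>S\<close> to a
  map with real coefficients. A map with real coefficients commutes with complex conjugation \<open>J\<close>, so
  \<open>S\<close> commutes with the reflection \<open>\<sigma> = inv T \<circ> J \<circ> T = A \<circ> J\<close>, where \<open>A = inv T \<circ> (cnj T)\<close>. The
  transformation \<open>T\<close> need not be defined over \<open>\<Q>\<close>, but \<open>A\<close> is: \<open>\<sigma>\<close> permutes the points that \<open>S\<close> takes to
  a fixed point in two steps. There are at least three such points (\<open>three_prefixed_points\<close>), and being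
  solutions of algebraic equations over \<open>\<Q>\<close> they all lie in the projective line over \<open>\<Q>\<close>
  (\<open>prefixed_in_sphere_over\<close>). So \<open>A\<close> takes three points over \<open>\<Q>\<close> to points over \<open>\<Q>\<close>, which forces its
  entries into \<open>\<Q>\<close> (\<open>moebius_over_if_three_points\<close>).

  Since \<open>\<sigma>\<close> is an involution coming from \<open>T\<close>, the matrix satisfies \<open>A (cnj A) = 1\<close>. By Hilbert's Theorem
  90 (\<open>cocycle_split\<close>) there is an invertible \<open>B\<close> over \<open>\<Q>\<close> with \<open>cnj B = B A\<close>, that is,
  \<open>J \<circ> B = B \<circ> \<sigma>\<close>. The conjugate of \<open>S\<close> by \<open>B\<close> is then a map over \<open>\<Q>\<close> that commutes with \<open>J\<close>, and
  normalising one coefficient to 1 puts its coefficients into \<open>\<real> \<inter> \<Q>\<close>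
  (\<open>rational_map_over_reals_if_commutes\<close>).
\<close>

section \<open>Subfields of the complex numbers\<close>

lemma subfield_closed:
  assumes "complex_subfield K"
  shows "0 \<in> K" and "1 \<in> K"
    and "x \<in> K \<Longrightarrow> y \<in> K \<Longrightarrow> x + y \<in> K"
    and "x \<in> K \<Longrightarrow> y \<in> K \<Longrightarrow> x * y \<in> K"
    and "x \<in> K \<Longrightarrow> - x \<in> K"
    and "x \<in> K \<Longrightarrow> y \<in> K \<Longrightarrow> x - y \<in> K"
    and "x \<in> K \<Longrightarrow> y \<in> K \<Longrightarrow> x / y \<in> K"
proof -
  show "x - y \<in> K" if "x \<in> K" "y \<in> K"
    using assms that by (metis complex_subfield_def diff_conv_add_uminus)
  show "x / y \<in> K" if "x \<in> K" "y \<in> K"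
    using assms that by (metis complex_subfield_def divide_inverse)
qed (use assms in \<open>auto simp: complex_subfield_def\<close>)

lemma subfield_sum_closed:
  assumes "complex_subfield K" and "\<And>i. i \<in> A \<Longrightarrow> f i \<in> K"
  shows "sum f A \<in> K"
  using assms(2)
  by (induction A rule: infinite_finite_induct) (auto simp: subfield_closed[OF assms(1)])

lemma subfield_poly_closed:
  assumes "complex_subfield K" and "\<forall>i. coeff p i \<in> K" and "x \<in> K"
  shows "poly p x \<in> K"
  using assms(2)
proof (induction p)
  case (pCons a p)
  have "coeff p i \<in> K" for i
    using pCons.prems[rule_format, of "Suc i"] by simp
  moreover have "a \<in> K"
    using pCons.prems[rule_format, of 0] by simp
  ultimately show ?case
    using pCons.IH assms(3) by (simp add: subfield_closed[OF assms(1)])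
qed (simp add: subfield_closed[OF assms(1)])

lemma subfield_coeff_mult_closed:
  assumes "complex_subfield K" and "\<forall>i. coeff p i \<in> K" and "\<forall>i. coeff q i \<in> K"
  shows "\<forall>i. coeff (p * q) i \<in> K"
  using assms(2,3) unfolding coeff_mult
  by (auto intro!: subfield_sum_closed[OF assms(1)] subfield_closed[OF assms(1)])

lemma subfield_coeff_linear_power_closed:
  assumes "complex_subfield K" and "a \<in> K" and "b \<in> K"
  shows "\<forall>i. coeff ([:b, a:] ^ k) i \<in> K"
proof (induction k)
  case (Suc k)
  have "\<forall>i. coeff [:b, a:] i \<in> K"
    using assms by (auto simp: coeff_pCons subfield_closed split: nat.split)
  from subfield_coeff_mult_closed[OF assms(1) this Suc] show ?case
    by simp
qed (auto simp: coeff_1 subfield_closed[OF assms(1)])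

lemma subfield_coeff_synthetic_div_closed:
  assumes "complex_subfield K" and "\<forall>i. coeff p i \<in> K" and "x \<in> K"
  shows "\<forall>i. coeff (synthetic_div p x) i \<in> K"
  using assms(2)
proof (induction p)
  case (pCons a p)
  have p: "\<forall>i. coeff p i \<in> K"
    using pCons.prems by (metis coeff_pCons_Suc)
  then have "poly p x \<in> K"
    using subfield_poly_closed assms(1,3) by blast
  then show ?case
    using pCons.IH[OF p] by (auto simp: coeff_pCons split: nat.split)
qed (simp add: subfield_closed[OF assms(1)])

text \<open>
  The definition only provides one root in \<open>K\<close> of every polynomial. Dividing that root out and
  descending on the degree shows that no root lies outside \<open>K\<close>.
\<close>

lemma alg_closed_subfield_root:
  assumes K: "alg_closed_subfield K"
    and "\<forall>i. coeff p i \<in> K" and "p \<noteq> 0" and "poly p x = 0"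
  shows "x \<in> K"
  using assms(2-4)
proof (induction "degree p" arbitrary: p rule: less_induct)
  case less
  have sub: "complex_subfield K"
    using K by (simp add: alg_closed_subfield_def)
  have deg: "degree p > 0"
    using less.prems(2,3) by (metis degree_eq_zeroE gr0I mult_zero_right poly_pCons pCons_0_0 add_0_right poly_0)
  then obtain y where y: "y \<in> K" "poly p y = 0"
    using K less.prems(1) by (auto simp: alg_closed_subfield_def)
  define q where "q = synthetic_div p y"
  have p: "p = [:- y, 1:] * q"
    using synthetic_div_correct'[of y p] y(2) by (simp add: q_def)
  show ?case
  proof (cases "x = y")
    case False
    have "q \<noteq> 0"
      using p less.prems(2) by auto
    moreover have "poly q x = 0"
      using less.prems(3) False by (subst (asm) p) simp
    moreover have "degree q < degree p"
      using deg by (simp add: q_def degree_synthetic_div)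
    moreover have "\<forall>i. coeff q i \<in> K"
      unfolding q_def using subfield_coeff_synthetic_div_closed[OF sub less.prems(1) y(1)] .
    ultimately show ?thesis
      using less.hyps by blast
  qed (use y in simp)
qed

lemma alg_closed_subfield_sqrt:
  assumes K: "alg_closed_subfield K" and "x\<^sup>2 \<in> K"
  shows "x \<in> K"
proof (rule alg_closed_subfield_root[OF K])
  have "complex_subfield K"
    using K by (simp add: alg_closed_subfield_def)
  then show "\<forall>i. coeff [:- x\<^sup>2, 0, 1:] i \<in> K"
    using assms(2) by (auto simp: coeff_pCons subfield_closed split: nat.split)
qed (auto simp: power2_eq_square)

section \<open>Homogeneous coordinates\<close>

text \<open>
  A nonzero vector \<open>(u, v)\<close> stands for the point \<open>u/v\<close>. In these coordinates infinity needs no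
  separate treatment in computations with rational maps.
\<close>

definition proj :: "complex \<Rightarrow> complex \<Rightarrow> riemann_sphere" where
  "proj u v = (if v = 0 then None else Some (u / v))"

lemma proj_surj: obtains u v where "x = proj u v" and "u \<noteq> 0 \<or> v \<noteq> 0"
proof (cases x)
  case None
  then show ?thesis
    using that[of 1 0] by (simp add: proj_def)
next
  case (Some z)
  then show ?thesis
    using that[of z 1] by (simp add: proj_def)
qed

lemma proj_eq_iff:
  assumes "u \<noteq> 0 \<or> v \<noteq> 0" and "u' \<noteq> 0 \<or> v' \<noteq> 0"
  shows "proj u v = proj u' v' \<longleftrightarrow> u * v' = u' * v"
  using assms by (auto simp: proj_def field_simps)

lemma proj_eq_imp_scaled:
  assumes "u \<noteq> 0 \<or> v \<noteq> 0" and "u' \<noteq> 0 \<or> v' \<noteq> 0" and "proj u v = proj u' v'"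
  obtains t where "u = t * u'" and "v = t * v'"
proof (cases "v' = 0")
  case True
  then have "u = (u / u') * u'" "v = (u / u') * v'"
    using assms by (auto simp: proj_def split: if_splits)
  then show ?thesis using that by blast
next
  case False
  then have "u = (v / v') * u'" "v = (v / v') * v'"
    using assms by (auto simp: proj_def field_simps split: if_splits)
  then show ?thesis using that by blast
qed

text \<open>
  The binary form \<open>v\<^sup>n P(u/v)\<close>, in a degree \<open>n\<close> that may exceed that of \<open>P\<close>; the form then
  vanishes at infinity.
\<close>

definition homog :: "nat \<Rightarrow> complex poly \<Rightarrow> complex \<Rightarrow> complex \<Rightarrow> complex" where
  "homog n P u v = (\<Sum>i\<le>n. coeff P i * u ^ i * v ^ (n - i))"

lemma homog_at_infinity: "homog n P u 0 = coeff P n * u ^ n"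
proof -
  have "homog n P u 0 = (\<Sum>i\<in>{n}. coeff P i * u ^ i * 0 ^ (n - i))"
    unfolding homog_def by (rule sum.mono_neutral_right) auto
  then show ?thesis by simp
qed

lemma homog_finite:
  assumes "degree P \<le> n" and "v \<noteq> 0"
  shows "homog n P u v = v ^ n * poly P (u / v)"
proof -
  have "poly P (u / v) = (\<Sum>i\<le>n. coeff P i * (u / v) ^ i)"
    unfolding poly_altdef using assms(1)
    by (intro sum.mono_neutral_left) (auto simp: coeff_eq_0)
  then show ?thesis
    unfolding homog_def using assms(2)
    by (auto simp: sum_distrib_left power_divide power_diff intro!: sum.cong)
qed

lemma homog_add: "homog n (P + Q) u v = homog n P u v + homog n Q u v"
  by (simp add: homog_def sum.distrib algebra_simps)

lemma homog_smult: "homog n (smult c P) u v = c * homog n P u v"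
  by (simp add: homog_def sum_distrib_left algebra_simps)

lemma homog_diff: "homog n (P - Q) u v = homog n P u v - homog n Q u v"
  by (simp add: homog_def sum_subtractf algebra_simps)

lemma homog_Suc:
  assumes "degree P \<le> n"
  shows "homog (Suc n) P u v = v * homog n P u v"
  using assms by (simp add: homog_def sum_distrib_left Suc_diff_le coeff_eq_0 algebra_simps)

lemma homog_pCons_0: "homog (Suc n) (pCons 0 P) u v = u * homog n P u v"
  unfolding homog_def sum.atMost_Suc_shift by (simp add: sum_distrib_left algebra_simps)

text \<open>
  A form of positive degree in two variables has a zero on the projective line: a root of the
  polynomial, or the point at infinity when the polynomial has degree below \<open>n\<close>.
\<close>

lemma homog_has_zero:
  assumes "n > 0" and "degree R \<le> n"
  obtains u v where "u \<noteq> 0 \<or> v \<noteq> 0" and "homog n R u v = 0"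
proof (cases "coeff R n = 0")
  case True
  then show ?thesis
    using that[of 1 0] by (simp add: homog_at_infinity)
next
  case False
  then have "degree R = n"
    using assms(2) le_degree by (metis le_antisym)
  then obtain z where "poly R z = 0"
    using assms(1) alg_closed_imp_poly_has_root by blast
  then show ?thesis
    using that[of z 1] assms(2) by (simp add: homog_finite)
qed

text \<open>
  Two forms without common zero on the projective line. For \<open>n = max (degree P) (degree Q)\<close> this is
  coprimality of \<open>P\<close> and \<open>Q\<close>, but stated so that it is visibly stable under a linear change of
  coordinates in the source or in the target.
\<close>

definition homogeneous_pair :: "nat \<Rightarrow> complex poly \<Rightarrow> complex poly \<Rightarrow> bool" where
  "homogeneous_pair n P Q \<longleftrightarrow>
     degree P \<le> n \<and> degree Q \<le> n \<and>
     (\<forall>u v. homog n P u v = 0 \<and> homog n Q u v = 0 \<longrightarrow> u = 0 \<and> v = 0)"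

lemma homogeneous_pair_degree:
  assumes "homogeneous_pair n P Q"
  shows "degree P \<le> n" and "degree Q \<le> n"
  using assms by (simp_all add: homogeneous_pair_def)

lemma homogeneous_pair_nontrivial:
  assumes "homogeneous_pair n P Q" and "u \<noteq> 0 \<or> v \<noteq> 0"
  shows "homog n P u v \<noteq> 0 \<or> homog n Q u v \<noteq> 0"
  using assms unfolding homogeneous_pair_def by blast

lemma homogeneous_pairI:
  assumes "degree P \<le> n" and "degree Q \<le> n"
    and "\<And>u v. u \<noteq> 0 \<or> v \<noteq> 0 \<Longrightarrow> homog n P u v \<noteq> 0 \<or> homog n Q u v \<noteq> 0"
  shows "homogeneous_pair n P Q"
  using assms unfolding homogeneous_pair_def by blast

lemma coprime_no_common_root:
  fixes P Q :: "complex poly"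
  assumes "coprime P Q" and "poly P z = 0"
  shows "poly Q z \<noteq> 0"
proof
  assume "poly Q z = 0"
  then have "[:- z, 1:] dvd P" "[:- z, 1:] dvd Q"
    using assms(2) by (simp_all add: poly_eq_0_iff_dvd)
  then have "is_unit [:- z, 1:]"
    using assms(1) coprime_common_divisor by blast
  then show False
    by (auto simp: is_unit_iff_degree)
qed

lemma coprime_imp_homogeneous_pair:
  assumes "coprime P Q"
  shows "homogeneous_pair (max (degree P) (degree Q)) P Q"
proof -
  define n where "n = max (degree P) (degree Q)"
  have deg: "degree P \<le> n" "degree Q \<le> n"
    by (auto simp: n_def)
  have top: "coeff P n \<noteq> 0 \<or> coeff Q n \<noteq> 0"
  proof (rule ccontr)
    assume "\<not> ?thesis"
    then have 0: "coeff P n = 0" "coeff Q n = 0"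
      by auto
    have "P = 0 \<or> Q = 0"
      using 0 by (metis n_def leading_coeff_0_iff max_def)
    then have "P = 0 \<and> Q = 0"
      using 0 by (auto simp: n_def)
    then show False
      using assms by simp
  qed
  have "u = 0 \<and> v = 0" if "homog n P u v = 0" "homog n Q u v = 0" for u v
  proof (cases "v = 0")
    case True
    then show ?thesis
      using that top by (auto simp: homog_at_infinity)
  next
    case False
    then show ?thesis
      using that deg coprime_no_common_root[OF assms] by (simp add: homog_finite)
  qed
  then show ?thesis
    using deg unfolding homogeneous_pair_def n_def by blast
qed

lemma homogeneous_pair_coeff:
  assumes "homogeneous_pair n P Q"
  shows "coeff P n \<noteq> 0 \<or> coeff Q n \<noteq> 0"
  using homogeneous_pair_nontrivial[OF assms, of 1 0] by (simp add: homog_at_infinity)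

text \<open>
  Infinity is not a common zero, so one of the two polynomials attains degree \<open>n\<close>.
\<close>

lemma homogeneous_pair_max_degree:
  assumes "homogeneous_pair n P Q"
  shows "max (degree P) (degree Q) = n"
proof -
  show ?thesis
    using homogeneous_pair_degree[OF assms] homogeneous_pair_coeff[OF assms] le_degree[of P n] le_degree[of Q n] by linarith
qed

lemma homogeneous_pair_imp_coprime:
  assumes "homogeneous_pair n P Q"
  shows "coprime P Q"
proof (rule coprimeI)
  fix D assume D: "D dvd P" "D dvd Q"
  have no_root: "poly D z \<noteq> 0" for z
  proof
    assume "poly D z = 0"
    then have "poly P z = 0" "poly Q z = 0"
      using D by (metis dvd_def mult_zero_left poly_mult)+
    then have "homog n P z 1 = 0" "homog n Q z 1 = 0"
      using homogeneous_pair_degree[OF assms] by (simp_all add: homog_finite)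
    then show False
      using homogeneous_pair_nontrivial[OF assms, of z 1] by simp
  qed
  then have "degree D = 0"
    using alg_closed_imp_poly_has_root[of D] by auto
  moreover have "D \<noteq> 0"
    using no_root by auto
  ultimately show "is_unit D"
    by (simp add: is_unit_iff_degree)
qed

text \<open>In homogeneous coordinates a rational map is given by one formula at all points.\<close>

lemma ratmap_proj:
  assumes "homogeneous_pair n P Q" and "u \<noteq> 0 \<or> v \<noteq> 0"
  shows "ratmap P Q (proj u v) = proj (homog n P u v) (homog n Q u v)"
proof (cases "v = 0")
  case True
  then show ?thesis
    using assms(2) unfolding ratmap_def Let_def homogeneous_pair_max_degree[OF assms(1)]
    by (simp add: proj_def homog_at_infinity)
next
  case False
  then show ?thesis
    using homogeneous_pair_degree[OF assms(1)] by (simp add: ratmap_def proj_def homog_finite)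
qed

lemma rational_map_over_iff_homogeneous_pair:
  "rational_map_over K \<phi> \<longleftrightarrow>
     (\<exists>n P Q. (\<forall>i. coeff P i \<in> K) \<and> (\<forall>i. coeff Q i \<in> K) \<and> n \<ge> 2 \<and>
              homogeneous_pair n P Q \<and> \<phi> = ratmap P Q)"
proof
  assume "rational_map_over K \<phi>"
  then show "\<exists>n P Q. (\<forall>i. coeff P i \<in> K) \<and> (\<forall>i. coeff Q i \<in> K) \<and> n \<ge> 2 \<and>
              homogeneous_pair n P Q \<and> \<phi> = ratmap P Q"
    unfolding rational_map_over_def using coprime_imp_homogeneous_pair by blast
next
  assume "\<exists>n P Q. (\<forall>i. coeff P i \<in> K) \<and> (\<forall>i. coeff Q i \<in> K) \<and> n \<ge> 2 \<and>
              homogeneous_pair n P Q \<and> \<phi> = ratmap P Q"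
  then obtain n P Q where *: "\<forall>i. coeff P i \<in> K" "\<forall>i. coeff Q i \<in> K" "n \<ge> 2"
    "homogeneous_pair n P Q" "\<phi> = ratmap P Q"
    by blast
  have "coprime P Q" "max (degree P) (degree Q) \<ge> 2"
    using homogeneous_pair_imp_coprime[OF *(4)] homogeneous_pair_max_degree[OF *(4)] *(3)
    by simp_all
  then show "rational_map_over K \<phi>"
    unfolding rational_map_over_def using *(1,2,5) by blast
qed

text \<open>
  At each \<open>z\<close> both maps have the same value, so \<open>P Q' = P' Q\<close> as polynomials; coprimality then
  leaves only a constant factor.
\<close>

lemma ratmap_eq_imp_proportional:
  assumes cop: "coprime P Q" "coprime P' Q'" and "Q \<noteq> 0"
    and eq: "ratmap P Q = ratmap P' Q'"
  obtains c where "P' = smult c P" and "Q' = smult c Q"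
proof -
  have "poly (P * Q') z = poly (P' * Q) z" for z
    using fun_cong[OF eq, of "Some z"] by (auto simp: ratmap_def field_simps split: if_splits)
  then have cross: "P * Q' = P' * Q"
    by (simp add: poly_eq_poly_eq_iff[symmetric] fun_eq_iff)
  have "Q dvd P * Q'" "Q' dvd P' * Q"
    by (metis cross dvd_triv_right) (metis cross dvd_triv_right)
  then have dvd: "Q dvd Q'" "Q' dvd Q"
    using cop coprime_dvd_mult_right_iff[of Q P Q'] coprime_dvd_mult_right_iff[of Q' P' Q]
    by (simp_all add: coprime_commute)
  from dvd(1) obtain r where r: "Q' = Q * r" ..
  from dvd(2) obtain s where s: "Q = Q' * s" ..
  have "Q * (r * s) = Q * 1"
    using r s by (metis mult.assoc mult.right_neutral)
  then have "r * s = 1"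
    using \<open>Q \<noteq> 0\<close> by (metis mult_cancel_left)
  then have "is_unit r"
    by (metis dvd_triv_left)
  then obtain c where c: "r = [:c:]"
    using is_unit_polyE by metis
  have Q': "Q' = smult c Q"
    using r c by simp
  have "P' * Q = smult c P * Q"
    using cross Q' by simp
  then have "P' = smult c P"
    using \<open>Q \<noteq> 0\<close> mult_right_cancel by blast
  then show ?thesis
    using Q' that by blast
qed

section \<open>Moebius transformations\<close>

lemma moebius_nontrivial:
  fixes a b c d :: complex
  assumes "a * d - b * c \<noteq> 0" and "u \<noteq> 0 \<or> v \<noteq> 0"
  shows "a * u + b * v \<noteq> 0 \<or> c * u + d * v \<noteq> 0"
proof (rule ccontr)
  assume "\<not> ?thesis"
  then have 0: "a * u + b * v = 0" "c * u + d * v = 0"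
    by auto
  have "(a * d - b * c) * u = d * (a * u + b * v) - b * (c * u + d * v)"
    "(a * d - b * c) * v = a * (c * u + d * v) - c * (a * u + b * v)"
    by (simp_all add: algebra_simps)
  then show False
    using 0 assms by simp
qed

lemma moebius_proj:
  assumes "a * d - b * c \<noteq> 0" and "u \<noteq> 0 \<or> v \<noteq> 0"
  shows "moebius a b c d (proj u v) = proj (a * u + b * v) (c * u + d * v)"
proof -
  have lin: "homog 1 [:q, p:] u v = p * u + q * v" for p q u v
    by (simp add: homog_def)
  have "homogeneous_pair 1 [:b, a:] [:d, c:]"
    unfolding homogeneous_pair_def lin
    using moebius_nontrivial[OF assms(1)] by (intro conjI) (simp, simp, blast)
  from ratmap_proj[OF this assms(2)] show ?thesis
    by (simp add: moebius_def lin[unfolded One_nat_def])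
qed

lemma moebius_comp:
  assumes "a * d - b * c \<noteq> 0" and "a' * d' - b' * c' \<noteq> 0"
  shows "moebius a b c d \<circ> moebius a' b' c' d' =
    moebius (a * a' + b * c') (a * b' + b * d') (c * a' + d * c') (c * b' + d * d')"
proof
  fix x
  obtain u v where x: "x = proj u v" and uv: "u \<noteq> 0 \<or> v \<noteq> 0"
    by (rule proj_surj)
  have "(a * a' + b * c') * (c * b' + d * d') - (a * b' + b * d') * (c * a' + d * c') =
    (a * d - b * c) * (a' * d' - b' * c')"
    by (simp add: algebra_simps)
  then have det: "(a * a' + b * c') * (c * b' + d * d') - (a * b' + b * d') * (c * a' + d * c') \<noteq> 0"
    using assms by simp
  show "(moebius a b c d \<circ> moebius a' b' c' d') x =
    moebius (a * a' + b * c') (a * b' + b * d') (c * a' + d * c') (c * b' + d * d') x"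
    unfolding x comp_def moebius_proj[OF assms(2) uv] moebius_proj[OF det uv]
      moebius_proj[OF assms(1) moebius_nontrivial[OF assms(2) uv]]
    by (simp add: algebra_simps)
qed

lemma moebius_scalar:
  assumes "t \<noteq> 0"
  shows "moebius t 0 0 t = id"
  using assms by (auto simp: fun_eq_iff moebius_def ratmap_def split: option.split)

lemma moebius_inverse_comp:
  assumes "a * d - b * c \<noteq> 0"
  shows "moebius d (- b) (- c) a \<circ> moebius a b c d = id"
    and "moebius a b c d \<circ> moebius d (- b) (- c) a = id"
proof -
  have det: "d * a - (- b) * (- c) \<noteq> 0"
    using assms by (simp add: algebra_simps)
  show "moebius d (- b) (- c) a \<circ> moebius a b c d = id"
    using moebius_comp[OF det assms] moebius_scalar[OF assms] by (simp add: algebra_simps)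
  show "moebius a b c d \<circ> moebius d (- b) (- c) a = id"
    using moebius_comp[OF assms det] moebius_scalar[OF assms] by (simp add: algebra_simps)
qed

lemma inv_moebius:
  assumes "a * d - b * c \<noteq> 0"
  shows "inv (moebius a b c d) = moebius d (- b) (- c) a"
  using inv_unique_comp[OF moebius_inverse_comp(2,1)[OF assms]] .

text \<open>
  Any invertible matrix can be rescaled to determinant 1 without changing its action. Working with
  arbitrary nonzero determinants keeps the entries inside a given field.
\<close>

lemma moebius_in_PSL2C:
  assumes "a * d - b * c \<noteq> 0"
  shows "moebius a b c d \<in> PSL2C"
proof -
  define t where "t = 1 / csqrt (a * d - b * c)"
  have t: "t \<noteq> 0" "t * t = 1 / (a * d - b * c)"
    using assms by (simp_all add: t_def power_divide flip: power2_eq_square)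
  have "moebius a b c d = moebius (t * a) (t * b) (t * c) (t * d)"
    using moebius_comp[of t t 0 0 a d b c] moebius_scalar[OF t(1)] t(1) assms by simp
  moreover have "(t * a) * (t * d) - (t * b) * (t * c) = t * t * (a * d - b * c)"
    by (simp add: algebra_simps)
  then have "(t * a) * (t * d) - (t * b) * (t * c) = 1"
    using t(2) assms by simp
  ultimately show ?thesis
    unfolding PSL2C_def by blast
qed

text \<open>
  A semiconjugacy equation needs no inverse, and so it can be read off at single points.
\<close>

lemma equivalent_iff:
  "equivalent \<phi> \<psi> \<longleftrightarrow> (\<exists>a b c d. a * d - b * c = 1 \<and> \<psi> \<circ> moebius a b c d = moebius a b c d \<circ> \<phi>)"
proof -
  have "\<psi> = T \<circ> \<phi> \<circ> inv T \<longleftrightarrow> \<psi> \<circ> T = T \<circ> \<phi>" if "T \<in> PSL2C" for T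
  proof
    have inv: "inv T \<circ> T = id" "T \<circ> inv T = id"
      using bij_PSL2C[OF that] by (simp_all add: bij_is_inj bij_is_surj flip: surj_iff)
    show "\<psi> \<circ> T = T \<circ> \<phi>" if "\<psi> = T \<circ> \<phi> \<circ> inv T"
      unfolding that by (simp add: comp_assoc inv)
    show "\<psi> = T \<circ> \<phi> \<circ> inv T" if "\<psi> \<circ> T = T \<circ> \<phi>"
      unfolding that[symmetric] by (simp add: comp_assoc inv)
  qed
  then show ?thesis
    unfolding equivalent_def PSL2C_def by blast
qed

lemma equivalent_if_moebius_conjugate:
  assumes "a * d - b * c \<noteq> 0" and "\<psi> \<circ> moebius a b c d = moebius a b c d \<circ> \<phi>"
  shows "equivalent \<phi> \<psi>"
proof -
  have "\<psi> = (\<psi> \<circ> moebius a b c d) \<circ> moebius d (- b) (- c) a"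
    using moebius_inverse_comp(2)[OF assms(1)] by (simp add: comp_assoc)
  then have "\<psi> = moebius a b c d \<circ> \<phi> \<circ> inv (moebius a b c d)"
    using assms by (simp add: inv_moebius)
  then show ?thesis
    using moebius_in_PSL2C[OF assms(1)] unfolding equivalent_def by blast
qed

lemma equivalent_common_source:
  assumes "equivalent \<phi> \<psi>" and "equivalent \<phi> \<chi>"
  shows "equivalent \<psi> \<chi>"
proof -
  obtain a b c d where 1: "a * d - b * c = 1" "\<psi> \<circ> moebius a b c d = moebius a b c d \<circ> \<phi>"
    using assms(1) by (auto simp: equivalent_iff)
  obtain a' b' c' d' where 2: "a' * d' - b' * c' = 1"
      "\<chi> \<circ> moebius a' b' c' d' = moebius a' b' c' d' \<circ> \<phi>"
    using assms(2) by (auto simp: equivalent_iff)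
  let ?T = "moebius a b c d" and ?T' = "moebius a' b' c' d'" and ?I = "moebius d (- b) (- c) a"
  have det: "a * d - b * c \<noteq> 0" "a' * d' - b' * c' \<noteq> 0" "d * a - (- b) * (- c) \<noteq> 0"
    using 1(1) 2(1) by (simp_all add: algebra_simps)
  define p q r s where "p = a' * d + b' * (- c)" and "q = a' * (- b) + b' * a"
    and "r = c' * d + d' * (- c)" and "s = c' * (- b) + d' * a"
  have M: "moebius p q r s = ?T' \<circ> ?I"
    unfolding p_def q_def r_def s_def by (rule moebius_comp[OF det(2,3), symmetric])
  have "p * s - q * r = (a * d - b * c) * (a' * d' - b' * c')"
    unfolding p_def q_def r_def s_def by (simp add: algebra_simps)
  then have "p * s - q * r \<noteq> 0"
    using det by simp
  moreover have "\<chi> \<circ> moebius p q r s = moebius p q r s \<circ> \<psi>"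
  proof -
    have id: "?I \<circ> ?T = id" "?T \<circ> ?I = id"
      using moebius_inverse_comp[OF det(1)] by simp_all
    have "\<chi> \<circ> (?T' \<circ> ?I) = ?T' \<circ> \<phi> \<circ> ?I"
      using 2(2) by (simp add: comp_assoc[symmetric])
    also have "\<dots> = ?T' \<circ> (?I \<circ> ?T) \<circ> \<phi> \<circ> ?I"
      by (simp add: id)
    also have "\<dots> = ?T' \<circ> ?I \<circ> (?T \<circ> \<phi>) \<circ> ?I"
      by (simp add: comp_assoc)
    also have "\<dots> = ?T' \<circ> ?I \<circ> \<psi> \<circ> (?T \<circ> ?I)"
      by (simp add: 1(2)[symmetric] comp_assoc)
    finally show ?thesis
      by (simp add: M id)
  qed
  ultimately show ?thesis
    by (rule equivalent_if_moebius_conjugate)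
qed

lemma equivalent_refl: "equivalent \<phi> \<phi>"
  by (rule equivalent_if_moebius_conjugate[of 1 1 0 0]) (simp_all add: moebius_scalar)

lemma equivalent_sym: "equivalent \<phi> \<psi> \<Longrightarrow> equivalent \<psi> \<phi>"
  using equivalent_common_source equivalent_refl by blast

section \<open>Conjugating a rational map by a Moebius transformation\<close>

text \<open>
  The polynomial whose form of degree \<open>n\<close> is that of \<open>P\<close> after the substitution
  \<open>(u, v) \<mapsto> (a u + b v, c u + d v)\<close>.
\<close>

definition linear_substitution ::
    "nat \<Rightarrow> complex \<Rightarrow> complex \<Rightarrow> complex \<Rightarrow> complex \<Rightarrow> complex poly \<Rightarrow> complex poly" where
  "linear_substitution n a b c d P =
     (\<Sum>i\<le>n. smult (coeff P i) ([:b, a:] ^ i * [:d, c:] ^ (n - i)))"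

lemma coeff_mult_top:
  fixes p q :: "complex poly"
  assumes "degree p \<le> m" and "degree q \<le> k"
  shows "coeff (p * q) (m + k) = coeff p m * coeff q k"
proof -
  have "coeff (p * q) (m + k) = (\<Sum>i\<in>{m}. coeff p i * coeff q (m + k - i))"
    unfolding coeff_mult
  proof (rule sum.mono_neutral_right)
    show "\<forall>i\<in>{..m + k} - {m}. coeff p i * coeff q (m + k - i) = 0"
    proof
      fix i assume i: "i \<in> {..m + k} - {m}"
      show "coeff p i * coeff q (m + k - i) = 0"
      proof (cases "i < m")
        case True
        then have "degree q < m + k - i"
          using assms by linarith
        then show ?thesis by (simp add: coeff_eq_0)
      next
        case False
        then have "degree p < i"
          using i assms by auto
        then show ?thesis by (simp add: coeff_eq_0)
      qed
    qed
  qed auto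
  then show ?thesis by simp
qed

lemma degree_linear_power_le: "degree ([:b, a :: complex:] ^ k) \<le> k"
  using degree_power_le[of "[:b, a:]" k] by (auto split: if_splits)

lemma coeff_linear_power_top: "coeff ([:b, a :: complex:] ^ k) k = a ^ k"
proof (induction k)
  case (Suc k)
  show ?case
    using coeff_mult_top[of "[:b, a:]" 1 "[:b, a:] ^ k" k] degree_linear_power_le Suc by simp
qed simp

lemma degree_linear_substitution: "degree (linear_substitution n a b c d P) \<le> n"
  unfolding linear_substitution_def
proof (rule degree_sum_le)
  fix i assume "i \<in> {..n}"
  have "degree ([:b, a:] ^ i * [:d, c:] ^ (n - i)) \<le> i + (n - i)"
    by (rule order.trans[OF degree_mult_le]) (intro add_mono degree_linear_power_le)
  then show "degree (smult (coeff P i) ([:b, a:] ^ i * [:d, c:] ^ (n - i))) \<le> n"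
    using \<open>i \<in> {..n}\<close> order.trans[OF degree_smult_le] by fastforce
qed simp

text \<open>
  For \<open>v \<noteq> 0\<close> both sides are values of polynomials at \<open>u/v\<close>. At infinity only the coefficient of degree
  \<open>n\<close> matters, and for a product of powers of linear factors it is the product of leading terms.
\<close>

lemma homog_linear_substitution:
  "homog n (linear_substitution n a b c d P) u v = homog n P (a * u + b * v) (c * u + d * v)"
proof (cases "v = 0")
  case True
  have "coeff ([:b, a:] ^ i * [:d, c:] ^ (n - i)) n = a ^ i * c ^ (n - i)" if "i \<le> n" for i
    using that coeff_mult_top[OF degree_linear_power_le degree_linear_power_le, of b a i d c "n - i"]
    by (simp add: coeff_linear_power_top)
  then have "coeff (linear_substitution n a b c d P) n * u ^ n =
      (\<Sum>i\<le>n. coeff P i * a ^ i * c ^ (n - i) * (u ^ i * u ^ (n - i)))"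
    by (simp add: linear_substitution_def coeff_sum sum_distrib_right mult.assoc flip: power_add)
  then show ?thesis
    using True unfolding homog_at_infinity[of n "linear_substitution n a b c d P", folded True]
    by (simp add: homog_def power_mult_distrib mult_ac)
next
  case False
  have "v ^ n * poly (linear_substitution n a b c d P) (u / v) =
      (\<Sum>i\<le>n. coeff P i * ((b + a * (u / v)) ^ i * (d + c * (u / v)) ^ (n - i)) * (v ^ i * v ^ (n - i)))"
    by (simp add: linear_substitution_def poly_sum sum_distrib_left mult_ac flip: power_add)
  also have "\<dots> = (\<Sum>i\<le>n. coeff P i * (v * (b + a * (u / v))) ^ i * (v * (d + c * (u / v))) ^ (n - i))"
    by (simp add: power_mult_distrib mult_ac)
  also have "\<dots> = homog n P (a * u + b * v) (c * u + d * v)"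
    using False by (simp add: homog_def distrib_left add.commute mult.commute)
  finally show ?thesis
    using False degree_linear_substitution by (simp add: homog_finite)
qed

lemma coeff_linear_substitution_closed:
  assumes "complex_subfield K" and "\<forall>i. coeff P i \<in> K"
    and "a \<in> K" "b \<in> K" "c \<in> K" "d \<in> K"
  shows "\<forall>i. coeff (linear_substitution n a b c d P) i \<in> K"
  unfolding linear_substitution_def coeff_sum coeff_smult
  using assms subfield_coeff_mult_closed[OF assms(1)] subfield_coeff_linear_power_closed[OF assms(1)]
  by (intro allI subfield_sum_closed[OF assms(1)]) (simp add: subfield_closed)

lemma rational_map_over_comp_moebius:
  assumes K: "complex_subfield K" and S: "rational_map_over K S"
    and abcd: "a \<in> K" "b \<in> K" "c \<in> K" "d \<in> K" and det: "a * d - b * c \<noteq> 0"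
  shows "rational_map_over K (S \<circ> moebius a b c d)"
proof -
  obtain n P Q where PQ: "\<forall>i. coeff P i \<in> K" "\<forall>i. coeff Q i \<in> K" "n \<ge> 2"
      "homogeneous_pair n P Q" "S = ratmap P Q"
    using S unfolding rational_map_over_iff_homogeneous_pair by blast
  let ?P = "linear_substitution n a b c d P" and ?Q = "linear_substitution n a b c d Q"
  have pair: "homogeneous_pair n ?P ?Q"
    unfolding homogeneous_pair_def homog_linear_substitution
    using degree_linear_substitution homogeneous_pair_nontrivial[OF PQ(4)]
      moebius_nontrivial[OF det] by blast
  have "S \<circ> moebius a b c d = ratmap ?P ?Q"
  proof
    fix x
    obtain u v where x: "x = proj u v" and uv: "u \<noteq> 0 \<or> v \<noteq> 0"
      by (rule proj_surj)
    show "(S \<circ> moebius a b c d) x = ratmap ?P ?Q x"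
      unfolding x comp_def PQ(5) moebius_proj[OF det uv] ratmap_proj[OF pair uv]
        ratmap_proj[OF PQ(4) moebius_nontrivial[OF det uv]] homog_linear_substitution ..
  qed
  then show ?thesis
    unfolding rational_map_over_iff_homogeneous_pair
    using pair PQ(3) coeff_linear_substitution_closed[OF K PQ(1) abcd]
      coeff_linear_substitution_closed[OF K PQ(2) abcd] by blast
qed

lemma moebius_comp_rational_map_over:
  assumes K: "complex_subfield K" and S: "rational_map_over K S"
    and abcd: "a \<in> K" "b \<in> K" "c \<in> K" "d \<in> K" and det: "a * d - b * c \<noteq> 0"
  shows "rational_map_over K (moebius a b c d \<circ> S)"
proof -
  obtain n P Q where PQ: "\<forall>i. coeff P i \<in> K" "\<forall>i. coeff Q i \<in> K" "n \<ge> 2"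
      "homogeneous_pair n P Q" "S = ratmap P Q"
    using S unfolding rational_map_over_iff_homogeneous_pair by blast
  let ?P = "smult a P + smult b Q" and ?Q = "smult c P + smult d Q"
  have h: "homog n ?P u v = a * homog n P u v + b * homog n Q u v"
    "homog n ?Q u v = c * homog n P u v + d * homog n Q u v" for u v
    by (simp_all add: homog_add homog_smult)
  have deg: "degree ?P \<le> n" "degree ?Q \<le> n"
    using homogeneous_pair_degree[OF PQ(4)]
    by (auto intro!: degree_add_le order.trans[OF degree_smult_le])
  have pair: "homogeneous_pair n ?P ?Q"
    unfolding homogeneous_pair_def h
    using deg homogeneous_pair_nontrivial[OF PQ(4)] moebius_nontrivial[OF det] by blast
  have "moebius a b c d \<circ> S = ratmap ?P ?Q"
  proof
    fix x
    obtain u v where x: "x = proj u v" and uv: "u \<noteq> 0 \<or> v \<noteq> 0"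
      by (rule proj_surj)
    show "(moebius a b c d \<circ> S) x = ratmap ?P ?Q x"
      unfolding x comp_def PQ(5) ratmap_proj[OF pair uv] ratmap_proj[OF PQ(4) uv]
        moebius_proj[OF det homogeneous_pair_nontrivial[OF PQ(4) uv]] h ..
  qed
  moreover have "\<forall>i. coeff ?P i \<in> K" "\<forall>i. coeff ?Q i \<in> K"
    using PQ(1,2) abcd by (simp_all add: subfield_closed[OF K])
  ultimately show ?thesis
    unfolding rational_map_over_iff_homogeneous_pair using pair PQ(3) by blast
qed

lemma rational_map_over_conjugate:
  assumes "complex_subfield K" and "rational_map_over K S"
    and "a \<in> K" "b \<in> K" "c \<in> K" "d \<in> K" and det: "a * d - b * c \<noteq> 0"
  shows "rational_map_over K (moebius a b c d \<circ> S \<circ> moebius d (- b) (- c) a)"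
proof -
  have "d * a - (- b) * (- c) \<noteq> 0"
    using det by (simp add: algebra_simps)
  then show ?thesis
    using assms by (intro rational_map_over_comp_moebius moebius_comp_rational_map_over)
      (simp_all add: subfield_closed[OF assms(1)])
qed

section \<open>Points that reach a fixed point in two steps\<close>

text \<open>
  The projective line over \<open>K\<close>.
\<close>

definition sphere_over :: "complex set \<Rightarrow> riemann_sphere set" where
  "sphere_over K = insert None (Some ` K)"

lemma sphere_over_proj:
  assumes "complex_subfield K" and "x \<in> sphere_over K"
  obtains u v where "u \<in> K" and "v \<in> K" and "u \<noteq> 0 \<or> v \<noteq> 0" and "x = proj u v"
proof (cases x)
  case None
  then show ?thesis
    using that[of 1 0] by (simp add: proj_def subfield_closed[OF assms(1)])
next
  case (Some z)
  then show ?thesis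
    using that[of z 1] assms(2) by (auto simp: proj_def sphere_over_def subfield_closed[OF assms(1)])
qed

lemma homog_zero_in_sphere_over:
  assumes "alg_closed_subfield K" and "\<forall>i. coeff R i \<in> K" and "R \<noteq> 0"
    and "degree R \<le> n" and "homog n R u v = 0"
  shows "proj u v \<in> sphere_over K"
proof (cases "v = 0")
  case False
  then have "poly R (u / v) = 0"
    using assms by (simp add: homog_finite)
  then show ?thesis
    using False alg_closed_subfield_root[OF assms(1-3)] by (simp add: proj_def sphere_over_def)
qed (simp add: proj_def sphere_over_def)

lemma rational_map_over_mono: "rational_map_over K S \<Longrightarrow> K \<subseteq> L \<Longrightarrow> rational_map_over L S"
  unfolding rational_map_over_def by blast

text \<open>
  The equation \<open>S x = p/q\<close> is the vanishing of the form \<open>q P - p Q\<close>, which has a zero.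
\<close>

lemma rational_map_surj:
  assumes "rational_map S"
  obtains x where "S x = y"
proof -
  obtain n P Q where PQ: "n \<ge> 2" "homogeneous_pair n P Q" "S = ratmap P Q"
    using assms unfolding rational_map_over_iff_homogeneous_pair by blast
  obtain p q where y: "y = proj p q" and pq: "p \<noteq> 0 \<or> q \<noteq> 0"
    by (rule proj_surj)
  have "degree (smult q P - smult p Q) \<le> n"
    using homogeneous_pair_degree[OF PQ(2)]
    by (auto intro!: degree_diff_le order.trans[OF degree_smult_le])
  then obtain u v where uv: "u \<noteq> 0 \<or> v \<noteq> 0" "homog n (smult q P - smult p Q) u v = 0"
    using homog_has_zero[of n] PQ(1) by auto
  have "S (proj u v) = y"
    unfolding PQ(3) y ratmap_proj[OF PQ(2) uv(1)]
      proj_eq_iff[OF homogeneous_pair_nontrivial[OF PQ(2) uv(1)] pq]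
    using uv(2) by (simp add: homog_diff homog_smult mult.commute)
  then show ?thesis using that by blast
qed

text \<open>
  The preimages of a point over \<open>K\<close> are the zeros of a form with coefficients in \<open>K\<close>. The form is
  not identically zero, as the map would otherwise be constant.
\<close>

lemma preimage_in_sphere_over:
  assumes K: "alg_closed_subfield K" and S: "rational_map_over K S"
    and x: "S x \<in> sphere_over K"
  shows "x \<in> sphere_over K"
proof -
  have sub: "complex_subfield K"
    using K by (simp add: alg_closed_subfield_def)
  obtain n P Q where PQ: "\<forall>i. coeff P i \<in> K" "\<forall>i. coeff Q i \<in> K" "n \<ge> 2"
      "homogeneous_pair n P Q" "S = ratmap P Q"
    using S unfolding rational_map_over_iff_homogeneous_pair by blast
  obtain p q where pq: "p \<in> K" "q \<in> K" "p \<noteq> 0 \<or> q \<noteq> 0" "S x = proj p q"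
    using sphere_over_proj[OF sub x] by blast
  define R where "R = smult q P - smult p Q"
  have R: "S (proj u v) = S x \<longleftrightarrow> homog n R u v = 0" if "u \<noteq> 0 \<or> v \<noteq> 0" for u v
    unfolding pq(4) unfolding PQ(5) ratmap_proj[OF PQ(4) that] R_def
      proj_eq_iff[OF homogeneous_pair_nontrivial[OF PQ(4) that] pq(3)]
    by (simp add: homog_diff homog_smult mult.commute)
  have "R \<noteq> 0"
  proof
    assume "R = 0"
    then have const: "S y = S x" for y
      using R by (metis homog_smult mult_zero_left proj_surj smult_0_left)
    have "rational_map S"
      using S rational_map_over_mono by blast
    then obtain y z where "S y = None" "S z = Some 0"
      by (metis rational_map_surj)
    then show False
      by (metis const option.distinct(1))
  qed
  moreover have "\<forall>i. coeff R i \<in> K"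
    using PQ(1,2) pq(1,2) by (simp add: R_def subfield_closed[OF sub])
  moreover have "degree R \<le> n"
    unfolding R_def using homogeneous_pair_degree[OF PQ(4)]
    by (auto intro!: degree_diff_le order.trans[OF degree_smult_le])
  moreover obtain u v where "x = proj u v" "u \<noteq> 0 \<or> v \<noteq> 0"
    by (rule proj_surj)
  ultimately show ?thesis
    using homog_zero_in_sphere_over[OF K] R by blast
qed

text \<open>
  The fixed points are the zeros of \<open>u Q - v P\<close>, a form of degree \<open>n + 1\<close>. It vanishes identically
  only for the identity map, which has degree 1.
\<close>

lemma fixed_point_form:
  assumes "n \<ge> 2" and pair: "homogeneous_pair n P Q"
  defines "R \<equiv> pCons 0 Q - P"
  shows "R \<noteq> 0" and "degree R \<le> Suc n"
    and "u \<noteq> 0 \<or> v \<noteq> 0 \<Longrightarrow> ratmap P Q (proj u v) = proj u v \<longleftrightarrow> homog (Suc n) R u v = 0"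
proof -
  show "R \<noteq> 0"
  proof
    assume "R = 0"
    then have P: "P = pCons 0 Q"
      by (simp add: R_def)
    then have "P = [:0, 1:] * Q"
      by simp
    then have "Q dvd P"
      by (metis dvd_triv_right)
    then have "is_unit Q"
      using coprime_common_divisor[OF homogeneous_pair_imp_coprime[OF pair]] by simp
    then have "degree Q = 0"
      by (auto elim!: is_unit_polyE)
    moreover then have "degree P \<le> 1"
      using degree_pCons_le[of 0 Q] by (simp add: P)
    ultimately show False
      using homogeneous_pair_max_degree[OF pair] \<open>n \<ge> 2\<close> by simp
  qed
  show "degree R \<le> Suc n"
    unfolding R_def using homogeneous_pair_degree[OF pair] degree_pCons_le[of 0 Q]
    by (intro degree_diff_le) linarith+
  assume uv: "u \<noteq> 0 \<or> v \<noteq> 0"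
  have "homog (Suc n) R u v = u * homog n Q u v - homog n P u v * v"
    using homog_Suc[OF homogeneous_pair_degree(1)[OF pair]]
    by (simp add: R_def homog_diff homog_pCons_0 mult.commute)
  then show "ratmap P Q (proj u v) = proj u v \<longleftrightarrow> homog (Suc n) R u v = 0"
    unfolding ratmap_proj[OF pair uv] proj_eq_iff[OF homogeneous_pair_nontrivial[OF pair uv] uv]
    by (metis eq_iff_diff_eq_0)
qed

lemma rational_map_has_fixed_point:
  assumes "rational_map S"
  obtains x where "S x = x"
proof -
  obtain n P Q where PQ: "n \<ge> 2" "homogeneous_pair n P Q" "S = ratmap P Q"
    using assms unfolding rational_map_over_iff_homogeneous_pair by blast
  obtain u v where "u \<noteq> 0 \<or> v \<noteq> 0" "homog (Suc n) (pCons 0 Q - P) u v = 0"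
    using homog_has_zero[OF _ fixed_point_form(2)[OF PQ(1,2)]] by auto
  then have "S (proj u v) = proj u v"
    using fixed_point_form(3)[OF PQ(1,2)] PQ(3) by simp
  then show ?thesis
    using that by blast
qed

lemma fixed_point_in_sphere_over:
  assumes K: "alg_closed_subfield K" and S: "rational_map_over K S" and "S x = x"
  shows "x \<in> sphere_over K"
proof -
  have sub: "complex_subfield K"
    using K by (simp add: alg_closed_subfield_def)
  obtain n P Q where PQ: "\<forall>i. coeff P i \<in> K" "\<forall>i. coeff Q i \<in> K" "n \<ge> 2"
      "homogeneous_pair n P Q" "S = ratmap P Q"
    using S unfolding rational_map_over_iff_homogeneous_pair by blast
  obtain u v where x: "x = proj u v" and uv: "u \<noteq> 0 \<or> v \<noteq> 0"
    by (rule proj_surj)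
  have "homog (Suc n) (pCons 0 Q - P) u v = 0"
    using fixed_point_form(3)[OF PQ(3,4) uv] assms(3) PQ(5) x by simp
  moreover have "\<forall>i. coeff (pCons 0 Q - P) i \<in> K"
    using PQ(1,2) by (auto simp: coeff_pCons subfield_closed[OF sub] split: nat.split)
  ultimately show ?thesis
    unfolding x using fixed_point_form(1,2)[OF PQ(3,4)] homog_zero_in_sphere_over[OF K] by blast
qed

text \<open>
  Two steps are what it takes to have three such points for every rational map: \<open>z \<mapsto> z + 1/z\<close> fixes
  only infinity, whose only other preimage is 0.
\<close>

definition prefixed :: "(riemann_sphere \<Rightarrow> riemann_sphere) \<Rightarrow> riemann_sphere set" where
  "prefixed S = {x. S (S (S x)) = S (S x)}"

lemma prefixed_in_sphere_over:
  assumes "alg_closed_subfield K" and "rational_map_over K S" and "x \<in> prefixed S"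
  shows "x \<in> sphere_over K"
proof -
  have "S (S x) \<in> sphere_over K"
    using assms fixed_point_in_sphere_over by (simp add: prefixed_def)
  then show ?thesis
    using preimage_in_sphere_over[OF assms(1,2)] by blast
qed

lemma polynomial_root_if_coeff:
  fixes p :: "complex poly"
  assumes "coeff p k \<noteq> 0" and "k > 0"
  obtains z where "poly p z = 0"
proof -
  have "degree p > 0"
    using le_degree[OF assms(1)] assms(2) by simp
  then show ?thesis
    using alg_closed_imp_poly_has_root that by blast
qed

text \<open>
  Infinity is fixed, and there is a finite fixed point \<open>\<beta>\<close>. If \<open>\<beta>\<close> has no preimage but itself, write
  \<open>p(z) = \<beta> + (z - \<beta>) G(z)\<close>. All roots of \<open>G\<close> are then equal to \<open>\<beta>\<close>, so a solution of \<open>G(z) = 1\<close> is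
  a further fixed point.
\<close>

lemma polynomial_three_prefixed:
  fixes p :: "complex poly"
  assumes deg: "degree p \<ge> 2" and S: "S None = None" "\<And>z. S (Some z) = Some (poly p z)"
  obtains x y z where "x \<in> prefixed S" "y \<in> prefixed S" "z \<in> prefixed S"
    and "x \<noteq> y" "y \<noteq> z" "x \<noteq> z"
proof -
  have lc: "coeff p (degree p) \<noteq> 0"
    using deg by auto
  have "coeff (p - [:0, 1:]) (degree p) \<noteq> 0"
    using lc deg by (auto simp: coeff_eq_0)
  then obtain \<beta> where "poly (p - [:0, 1:]) \<beta> = 0"
    using polynomial_root_if_coeff deg by (metis less_le_trans zero_less_numeral)
  then have \<beta>: "poly p \<beta> = \<beta>"
    by simp
  have "\<exists>\<gamma>. \<gamma> \<noteq> \<beta> \<and> Some \<gamma> \<in> prefixed S"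
  proof (cases "\<exists>\<gamma>. \<gamma> \<noteq> \<beta> \<and> poly p \<gamma> = \<beta>")
    case True
    then obtain \<gamma> where "\<gamma> \<noteq> \<beta>" "poly p \<gamma> = \<beta>"
      by blast
    moreover from this have "Some \<gamma> \<in> prefixed S"
      by (simp add: prefixed_def S \<beta>)
    ultimately show ?thesis
      by blast
  next
    case False
    define G where "G = synthetic_div (p - [:\<beta>:]) \<beta>"
    have "p - [:\<beta>:] = [:- \<beta>, 1:] * G"
      using synthetic_div_correct'[of \<beta> "p - [:\<beta>:]"] \<beta> by (simp add: G_def)
    then have "poly p z - \<beta> = poly ([:- \<beta>, 1:] * G) z" for z
      by (metis poly_diff poly_pCons poly_0 mult_zero_right add_0_right)
    then have p: "poly p z = \<beta> + (z - \<beta>) * poly G z" for z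
      by (simp add: algebra_simps)
    have "coeff (p - [:\<beta>:]) (degree p) \<noteq> 0"
      using lc deg by (auto simp: coeff_eq_0)
    then have "degree (p - [:\<beta>:]) \<ge> 2"
      using le_degree deg order.trans by blast
    then have "degree G > 0"
      by (simp add: G_def degree_synthetic_div)
    moreover from this have "lead_coeff G \<noteq> 0"
      using leading_coeff_0_iff by fastforce
    ultimately have G: "coeff G (degree G) \<noteq> 0" "coeff (G - 1) (degree G) \<noteq> 0" "degree G > 0"
      by (simp_all add: coeff_eq_0)
    obtain z where "poly G z = 0"
      using polynomial_root_if_coeff[OF G(1,3)] by blast
    moreover from this have "poly p z = \<beta>"
      using p[of z] by simp
    then have "z = \<beta>"
      using False by blast
    ultimately have "poly G \<beta> = 0"
      by simp
    obtain \<delta> where "poly (G - 1) \<delta> = 0"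
      using polynomial_root_if_coeff[OF G(2,3)] by blast
    then have "poly G \<delta> = 1"
      by simp
    then have "poly p \<delta> = \<delta>" "\<delta> \<noteq> \<beta>"
      using p[of \<delta>] \<open>poly G \<beta> = 0\<close> by auto
    then show ?thesis
      by (auto simp: prefixed_def S)
  qed
  then obtain \<gamma> where "\<gamma> \<noteq> \<beta>" "Some \<gamma> \<in> prefixed S"
    by blast
  moreover have "None \<in> prefixed S" "Some \<beta> \<in> prefixed S"
    by (simp_all add: prefixed_def S \<beta>)
  ultimately show ?thesis
    using that[of None "Some \<beta>" "Some \<gamma>"] by auto
qed

text \<open>
  If a fixed point \<open>\<alpha>\<close> has a preimage \<open>\<beta> \<noteq> \<alpha>\<close>, then \<open>\<alpha>\<close>, \<open>\<beta>\<close> and any preimage of \<open>\<beta>\<close> will do. If it has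
  none, moving \<open>\<alpha>\<close> to infinity turns the map into a polynomial.
\<close>

lemma three_prefixed_points:
  assumes S: "rational_map S"
  obtains x y z where "x \<in> prefixed S" "y \<in> prefixed S" "z \<in> prefixed S"
    and "x \<noteq> y" "y \<noteq> z" "x \<noteq> z"
proof -
  obtain \<alpha> where \<alpha>: "S \<alpha> = \<alpha>"
    using rational_map_has_fixed_point[OF S] by blast
  show ?thesis
  proof (cases "\<exists>\<beta>. \<beta> \<noteq> \<alpha> \<and> S \<beta> = \<alpha>")
    case True
    then obtain \<beta> where \<beta>: "\<beta> \<noteq> \<alpha>" "S \<beta> = \<alpha>"
      by blast
    obtain \<gamma> where \<gamma>: "S \<gamma> = \<beta>"
      using rational_map_surj[OF S] by blast
    have "\<alpha> \<in> prefixed S" "\<beta> \<in> prefixed S" "\<gamma> \<in> prefixed S"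
      by (simp_all add: prefixed_def \<alpha> \<beta> \<gamma>)
    moreover have "\<gamma> \<noteq> \<alpha>" "\<gamma> \<noteq> \<beta>"
      using \<alpha> \<beta> \<gamma> by metis+
    ultimately show ?thesis
      using that \<beta>(1) by metis
  next
    case False
    obtain a b c d where det: "a * d - b * c \<noteq> 0" and M: "moebius a b c d \<alpha> = None"
    proof (cases \<alpha>)
      case None
      then show ?thesis
        using that[of 1 1 0 0] by (simp add: moebius_scalar)
    next
      case (Some w)
      then show ?thesis
        using that[of 0 "- w" 1 1] by (simp add: moebius_Some)
    qed
    define M where "M = moebius a b c d"
    define M' where "M' = moebius d (- b) (- c) a"
    have inv: "M' (M x) = x" "M (M' x) = x" for x
      using moebius_inverse_comp[OF det] by (simp_all add: M_def M'_def fun_eq_iff)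
    define S' where "S' = M \<circ> S \<circ> M'"
    have "complex_subfield UNIV"
      by (simp add: complex_subfield_def)
    then have "rational_map S'"
      unfolding S'_def M_def M'_def using rational_map_over_conjugate S det by blast
    then obtain P Q where PQ: "coprime P Q" "max (degree P) (degree Q) \<ge> 2" "S' = ratmap P Q"
      unfolding rational_map_over_def by blast
    have "M \<alpha> = None"
      using M by (simp add: M_def)
    then have S'_None: "S' x = None \<longleftrightarrow> x = None" for x
      using \<alpha> False inv unfolding S'_def comp_def by metis
    have "poly Q z \<noteq> 0" for z
      using S'_None[of "Some z"] by (simp add: PQ(3) ratmap_def split: if_splits)
    then have Q: "degree Q = 0"
      using alg_closed_imp_poly_has_root[of Q] by blast
    then obtain q where q: "Q = [:q:]"
      by (rule degree_eq_zeroE)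
    have "q \<noteq> 0"
      using \<open>\<And>z. poly Q z \<noteq> 0\<close> by (simp add: q)
    then have "S' (Some z) = Some (poly (smult (1 / q) P) z)" for z
      by (simp add: PQ(3) ratmap_def q)
    moreover have "degree (smult (1 / q) P) \<ge> 2"
      using PQ(2) Q \<open>q \<noteq> 0\<close> by simp
    ultimately obtain x y z where "x \<in> prefixed S'" "y \<in> prefixed S'" "z \<in> prefixed S'"
        "x \<noteq> y" "y \<noteq> z" "x \<noteq> z"
      using polynomial_three_prefixed[of "smult (1 / q) P" S'] S'_None by blast
    moreover have "M' w \<in> prefixed S" if "w \<in> prefixed S'" for w
      using that inv unfolding prefixed_def S'_def comp_def mem_Collect_eq by metis
    moreover have "M' v \<noteq> M' w" if "v \<noteq> w" for v w
      using that inv by metis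
    ultimately show ?thesis
      using that by meson
  qed
qed

lemma prefixed_commute:
  assumes "S \<circ> \<sigma> = \<sigma> \<circ> S" and "x \<in> prefixed S"
  shows "\<sigma> x \<in> prefixed S"
  using assms by (simp add: prefixed_def fun_eq_iff)

section \<open>Moebius transformations determined by three points\<close>

text \<open>
  Let \<open>x\<^sub>i\<close> be vectors over \<open>K\<close> representing the points and \<open>y\<^sub>i\<close> vectors over \<open>K\<close> representing their
  images, so that the matrix sends \<open>x\<^sub>i\<close> to \<open>t\<^sub>i y\<^sub>i\<close>. It preserves the bracket
  \<open>[x, x'] = u v' - u' v\<close>, since its determinant is 1; hence \<open>t\<^sub>i t\<^sub>j = [x\<^sub>i, x\<^sub>j] / [y\<^sub>i, y\<^sub>j]\<close> lies in \<open>K\<close> for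
  \<open>i \<noteq> j\<close>. So does \<open>t\<^sub>1\<^sup>2 = (t\<^sub>1 t\<^sub>2)(t\<^sub>1 t\<^sub>3)/(t\<^sub>2 t\<^sub>3)\<close>, and \<open>K\<close> is closed under square roots. The values at two
  independent vectors then give the entries by Cramer's rule.
\<close>

lemma moebius_over_if_three_points:
  assumes K: "alg_closed_subfield K" and det: "a * d - b * c = 1"
    and x: "x1 \<in> sphere_over K" "x2 \<in> sphere_over K" "x3 \<in> sphere_over K"
    and y: "moebius a b c d x1 \<in> sphere_over K" "moebius a b c d x2 \<in> sphere_over K"
      "moebius a b c d x3 \<in> sphere_over K"
    and distinct: "x1 \<noteq> x2" "x2 \<noteq> x3" "x1 \<noteq> x3"
  shows "a \<in> K \<and> b \<in> K \<and> c \<in> K \<and> d \<in> K"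
proof -
  have sub: "complex_subfield K"
    using K by (simp add: alg_closed_subfield_def)
  have lift: "\<exists>u v t p q. u \<in> K \<and> v \<in> K \<and> p \<in> K \<and> q \<in> K \<and> (u \<noteq> 0 \<or> v \<noteq> 0) \<and> x = proj u v \<and>
      a * u + b * v = t * p \<and> c * u + d * v = t * q"
    if "x \<in> sphere_over K" "moebius a b c d x \<in> sphere_over K" for x
  proof -
    obtain u v where uv: "u \<in> K" "v \<in> K" "u \<noteq> 0 \<or> v \<noteq> 0" "x = proj u v"
      using sphere_over_proj[OF sub \<open>x \<in> sphere_over K\<close>] by blast
    obtain p q where pq: "p \<in> K" "q \<in> K" "p \<noteq> 0 \<or> q \<noteq> 0" "moebius a b c d x = proj p q"
      using sphere_over_proj[OF sub \<open>moebius a b c d x \<in> sphere_over K\<close>] by blast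
    have det0: "a * d - b * c \<noteq> 0"
      using det by simp
    have "proj (a * u + b * v) (c * u + d * v) = proj p q"
      using moebius_proj[OF det0 uv(3)] pq(4) uv(4) by simp
    then obtain t where "a * u + b * v = t * p" "c * u + d * v = t * q"
      using proj_eq_imp_scaled[OF moebius_nontrivial[OF det0 uv(3)] pq(3)] by blast
    then show ?thesis
      using uv pq by blast
  qed
  obtain u1 v1 t1 p1 q1 where 1: "u1 \<in> K" "v1 \<in> K" "p1 \<in> K" "q1 \<in> K" "u1 \<noteq> 0 \<or> v1 \<noteq> 0"
      "x1 = proj u1 v1" "a * u1 + b * v1 = t1 * p1" "c * u1 + d * v1 = t1 * q1"
    using lift[OF x(1) y(1)] by blast
  obtain u2 v2 t2 p2 q2 where 2: "u2 \<in> K" "v2 \<in> K" "p2 \<in> K" "q2 \<in> K" "u2 \<noteq> 0 \<or> v2 \<noteq> 0"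
      "x2 = proj u2 v2" "a * u2 + b * v2 = t2 * p2" "c * u2 + d * v2 = t2 * q2"
    using lift[OF x(2) y(2)] by blast
  obtain u3 v3 t3 p3 q3 where 3: "u3 \<in> K" "v3 \<in> K" "p3 \<in> K" "q3 \<in> K" "u3 \<noteq> 0 \<or> v3 \<noteq> 0"
      "x3 = proj u3 v3" "a * u3 + b * v3 = t3 * p3" "c * u3 + d * v3 = t3 * q3"
    using lift[OF x(3) y(3)] by blast
  \<comment> \<open>The scale factors of two distinct points, through the bracket.\<close>
  have bracket: "t * t' \<in> K \<and> t * t' \<noteq> 0"
    if "a * u + b * v = t * p" "c * u + d * v = t * q"
      "a * u' + b * v' = t' * p'" "c * u' + d * v' = t' * q'"
      "u * v' \<noteq> u' * v" "u \<in> K" "v \<in> K" "u' \<in> K" "v' \<in> K" "p \<in> K" "q \<in> K" "p' \<in> K" "q' \<in> K"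
    for u v u' v' t t' p q p' q'
  proof -
    have "t * t' * (p * q' - p' * q) = (t * p) * (t' * q') - (t' * p') * (t * q)"
      by (simp add: algebra_simps)
    also have "\<dots> = (a * d - b * c) * (u * v' - u' * v)"
      unfolding that(1-4)[symmetric] by (simp add: algebra_simps)
    finally have eq: "t * t' * (p * q' - p' * q) = u * v' - u' * v"
      by (simp add: det)
    then have nz: "p * q' - p' * q \<noteq> 0" "t * t' \<noteq> 0"
      using that(5) by auto
    then have "t * t' = (u * v' - u' * v) / (p * q' - p' * q)"
      using eq by (simp add: field_simps)
    then show ?thesis
      using that nz(2) by (simp add: subfield_closed[OF sub])
  qed
  have cross: "u1 * v2 \<noteq> u2 * v1" "u2 * v3 \<noteq> u3 * v2" "u1 * v3 \<noteq> u3 * v1"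
    using distinct 1 2 3 proj_eq_iff by metis+
  have t12: "t1 * t2 \<in> K \<and> t1 * t2 \<noteq> 0"
    using bracket[OF 1(7,8) 2(7,8) cross(1)] 1 2 by blast
  have t23: "t2 * t3 \<in> K \<and> t2 * t3 \<noteq> 0"
    using bracket[OF 2(7,8) 3(7,8) cross(2)] 2 3 by blast
  have t13: "t1 * t3 \<in> K \<and> t1 * t3 \<noteq> 0"
    using bracket[OF 1(7,8) 3(7,8) cross(3)] 1 3 by blast
  have "t1\<^sup>2 = (t1 * t2) * (t1 * t3) / (t2 * t3)"
    using t12 t23 t13 by (simp add: power2_eq_square)
  then have "t1\<^sup>2 \<in> K"
    using t12 t23 t13 subfield_closed[OF sub] by presburger
  then have t1: "t1 \<in> K"
    using alg_closed_subfield_sqrt[OF K] by blast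
  have "t2 = (t1 * t2) / t1"
    using t12 by simp
  then have t2: "t2 \<in> K"
    using t1 t12 subfield_closed(7)[OF sub] by metis
  define \<delta> where "\<delta> = u1 * v2 - u2 * v1"
  have \<delta>: "\<delta> \<noteq> 0" "\<delta> \<in> K"
    using cross(1) 1 2 by (simp_all add: \<delta>_def subfield_closed[OF sub])
  have cramer: "m \<in> K \<and> n \<in> K"
    if "m * u1 + n * v1 = t1 * r1" "m * u2 + n * v2 = t2 * r2" "r1 \<in> K" "r2 \<in> K" for m n r1 r2
  proof -
    have "m * \<delta> = (t1 * r1) * v2 - (t2 * r2) * v1" "n * \<delta> = u1 * (t2 * r2) - u2 * (t1 * r1)"
      unfolding that(1,2)[symmetric] \<delta>_def by (simp_all add: algebra_simps)
    then have "m = ((t1 * r1) * v2 - (t2 * r2) * v1) / \<delta>" "n = (u1 * (t2 * r2) - u2 * (t1 * r1)) / \<delta>"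
      using \<delta>(1) by (simp_all add: field_simps)
    then show ?thesis
      using that(3,4) 1 2 t1 t2 \<delta>(2) by (simp add: subfield_closed[OF sub])
  qed
  show ?thesis
    using cramer[OF 1(7) 2(7)] cramer[OF 1(8) 2(8)] 1 2 by blast
qed

section \<open>Complex conjugation and descent to the reals\<close>

abbreviation conj_sphere :: "riemann_sphere \<Rightarrow> riemann_sphere" where
  "conj_sphere \<equiv> map_option cnj"

lemma conj_sphere_proj: "conj_sphere (proj u v) = proj (cnj u) (cnj v)"
  by (simp add: proj_def)

lemma conj_sphere_involution: "conj_sphere (conj_sphere x) = x"
  by (cases x) auto

lemma conj_sphere_sphere_over:
  assumes "conjugate_invariant K" and "x \<in> sphere_over K"
  shows "conj_sphere x \<in> sphere_over K"
  using assms by (auto simp: sphere_over_def conjugate_invariant_def)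

lemma conj_sphere_moebius:
  assumes "a * d - b * c \<noteq> 0"
  shows "conj_sphere (moebius a b c d x) = moebius (cnj a) (cnj b) (cnj c) (cnj d) (conj_sphere x)"
proof -
  obtain u v where x: "x = proj u v" and uv: "u \<noteq> 0 \<or> v \<noteq> 0"
    by (rule proj_surj)
  have "cnj (a * d - b * c) \<noteq> 0"
    using assms by (simp only: complex_cnj_zero_iff not_False_eq_True)
  then have "cnj a * cnj d - cnj b * cnj c \<noteq> 0"
    by simp
  moreover have "cnj u \<noteq> 0 \<or> cnj v \<noteq> 0"
    using uv by simp
  ultimately show ?thesis
    unfolding x moebius_proj[OF assms uv] conj_sphere_proj by (simp add: moebius_proj)
qed

lemma homog_cnj: "homog n (map_poly cnj P) u v = cnj (homog n P (cnj u) (cnj v))"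
  by (simp add: homog_def coeff_map_poly)

lemma homogeneous_pair_cnj:
  assumes "homogeneous_pair n P Q"
  shows "homogeneous_pair n (map_poly cnj P) (map_poly cnj Q)"
  using assms homogeneous_pair_nontrivial[OF assms]
  unfolding homogeneous_pair_def homog_cnj complex_cnj_zero_iff
  by (metis complex_cnj_zero_iff map_poly_degree_leq order.trans)

lemma conj_sphere_ratmap:
  assumes "homogeneous_pair n P Q"
  shows "conj_sphere (ratmap P Q x) = ratmap (map_poly cnj P) (map_poly cnj Q) (conj_sphere x)"
proof -
  obtain u v where x: "x = proj u v" and uv: "u \<noteq> 0 \<or> v \<noteq> 0"
    by (rule proj_surj)
  have uv': "cnj u \<noteq> 0 \<or> cnj v \<noteq> 0"
    using uv by simp
  show ?thesis
    unfolding x ratmap_proj[OF assms uv] conj_sphere_proj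
      ratmap_proj[OF homogeneous_pair_cnj[OF assms] uv'] homog_cnj by simp
qed

lemma rational_map_over_reals_commutes:
  assumes "rational_map_over \<real> R"
  shows "R \<circ> conj_sphere = conj_sphere \<circ> R"
proof -
  obtain n P Q where PQ: "\<forall>i. coeff P i \<in> \<real>" "\<forall>i. coeff Q i \<in> \<real>"
      "homogeneous_pair n P Q" "R = ratmap P Q"
    using assms unfolding rational_map_over_iff_homogeneous_pair by blast
  have "map_poly cnj P = P" "map_poly cnj Q = Q"
    using PQ(1,2) by (auto intro!: poly_eqI simp: coeff_map_poly Reals_cnj_iff)
  then show ?thesis
    using conj_sphere_ratmap[OF PQ(3)] by (auto simp: fun_eq_iff PQ(4))
qed

text \<open>
  Since the map commutes with complex conjugation, conjugating the coefficients does not change it, and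
  thus multiplies all of them by one common factor. Ratios of coefficients are therefore real, and
  dividing by one nonzero coefficient makes all coefficients real without leaving \<open>K\<close>.
\<close>

lemma rational_map_over_reals_if_commutes:
  assumes K: "complex_subfield K" and S: "rational_map_over K S"
    and comm: "S \<circ> conj_sphere = conj_sphere \<circ> S"
  shows "rational_map_over (\<real> \<inter> K) S"
proof -
  obtain n P Q where PQ: "\<forall>i. coeff P i \<in> K" "\<forall>i. coeff Q i \<in> K" "n \<ge> 2"
      "homogeneous_pair n P Q" "S = ratmap P Q"
    using S unfolding rational_map_over_iff_homogeneous_pair by blast
  have cop: "coprime P Q" "coprime (map_poly cnj P) (map_poly cnj Q)"
    using homogeneous_pair_imp_coprime[OF PQ(4)]
      homogeneous_pair_imp_coprime[OF homogeneous_pair_cnj[OF PQ(4)]] by simp_all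
  have "Q \<noteq> 0"
  proof
    assume "Q = 0"
    then have "degree P = 0"
      using cop(1) by (auto elim!: is_unit_polyE)
    then show False
      using homogeneous_pair_max_degree[OF PQ(4)] \<open>Q = 0\<close> PQ(3) by simp
  qed
  moreover have "ratmap P Q x = ratmap (map_poly cnj P) (map_poly cnj Q) x" for x
  proof -
    have "ratmap (map_poly cnj P) (map_poly cnj Q) x = conj_sphere (S (conj_sphere x))"
      using conj_sphere_ratmap[OF PQ(4), of "conj_sphere x"] by (simp add: conj_sphere_involution PQ(5))
    then show ?thesis
      using fun_cong[OF comm, of x] by (simp add: conj_sphere_involution PQ(5))
  qed
  ultimately obtain t where t: "map_poly cnj P = smult t P" "map_poly cnj Q = smult t Q"
    using ratmap_eq_imp_proportional[OF cop] by blast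
  have cnj_coeff: "cnj (coeff P i) = t * coeff P i" "cnj (coeff Q i) = t * coeff Q i" for i
    using arg_cong[OF t(1), of "\<lambda>p. coeff p i"] arg_cong[OF t(2), of "\<lambda>p. coeff p i"]
    by (simp_all add: coeff_map_poly)
  define k where "k = lead_coeff Q"
  have k: "k \<noteq> 0" "k \<in> K" "cnj k = t * k"
    using \<open>Q \<noteq> 0\<close> PQ(2) cnj_coeff by (simp_all add: k_def)
  then have "t \<noteq> 0"
    by auto
  let ?P = "smult (1 / k) P" and ?Q = "smult (1 / k) Q"
  have "coeff ?P i \<in> \<real> \<inter> K" "coeff ?Q i \<in> \<real> \<inter> K" for i
    using PQ(1,2) k \<open>t \<noteq> 0\<close> cnj_coeff
    by (simp_all add: Reals_cnj_iff subfield_closed[OF K])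
  moreover have "homogeneous_pair n ?P ?Q"
  proof (rule homogeneous_pairI)
    show "degree ?P \<le> n" "degree ?Q \<le> n"
      using homogeneous_pair_degree[OF PQ(4)] k(1) by simp_all
    show "homog n ?P u v \<noteq> 0 \<or> homog n ?Q u v \<noteq> 0" if "u \<noteq> 0 \<or> v \<noteq> 0" for u v
      using homogeneous_pair_nontrivial[OF PQ(4) that] k(1) by (simp add: homog_smult)
  qed
  moreover have "S = ratmap ?P ?Q"
    using k(1) by (auto simp: PQ(5) ratmap_def fun_eq_iff Let_def split: option.split)
  ultimately show ?thesis
    unfolding rational_map_over_iff_homogeneous_pair using PQ(3) by blast
qed

text \<open>
  Hilbert's Theorem 90 for 2 by 2 matrices: if \<open>A = (p, q; r, s)\<close> satisfies \<open>A (cnj A) = 1\<close>, then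
  \<open>cnj B = B A\<close> has an invertible solution \<open>B = (e, f; g, h)\<close> over \<open>K\<close>. For every scalar \<open>m\<close> the average
  \<open>B = m + (cnj m) (cnj A)\<close> is a solution. As \<open>A\<close> has determinant 1, that of \<open>B\<close> is
  \<open>m\<^sup>2 + m (cnj m) \<tau> + (cnj m)\<^sup>2\<close>, where \<open>\<tau>\<close> is the trace of \<open>cnj A\<close>; at \<open>m = 1\<close> this is \<open>2 + \<tau>\<close>, and at \<open>m = \<i>\<close>
  it is \<open>\<tau> - 2\<close>, so one of the two choices works.
\<close>

lemma cocycle_split:
  assumes K: "alg_closed_subfield K" and conj: "conjugate_invariant K"
    and pqrs: "p \<in> K" "q \<in> K" "r \<in> K" "s \<in> K" and det: "p * s - q * r = 1"
    and cocycle: "p * cnj p + q * cnj r = 1" "p * cnj q + q * cnj s = 0"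
      "r * cnj p + s * cnj r = 0" "r * cnj q + s * cnj s = 1"
  obtains e f g h where "e \<in> K" "f \<in> K" "g \<in> K" "h \<in> K" "e * h - f * g \<noteq> 0"
    and "cnj e = e * p + f * r" "cnj f = e * q + f * s"
    and "cnj g = g * p + h * r" "cnj h = g * q + h * s"
proof -
  have sub: "complex_subfield K"
    using K by (simp add: alg_closed_subfield_def)
  have cnj_K: "cnj x \<in> K" if "x \<in> K" for x
    using conj that by (auto simp: conjugate_invariant_def)
  note intro = that
  have B: thesis if m: "m \<in> K" "m\<^sup>2 + m * cnj m * (cnj p + cnj s) + (cnj m)\<^sup>2 \<noteq> 0" for m
  proof (rule intro)
    show "m + cnj m * cnj p \<in> K" "cnj m * cnj q \<in> K" "cnj m * cnj r \<in> K" "m + cnj m * cnj s \<in> K"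
      using pqrs m(1) by (simp_all add: cnj_K subfield_closed[OF sub])
    have "cnj p * cnj s - cnj q * cnj r = 1"
      using arg_cong[OF det, of cnj] by simp
    moreover have "(m + cnj m * cnj p) * (m + cnj m * cnj s) - cnj m * cnj q * (cnj m * cnj r) =
        m\<^sup>2 + m * cnj m * (cnj p + cnj s) + (cnj m)\<^sup>2 * (cnj p * cnj s - cnj q * cnj r)"
      by (simp add: algebra_simps power2_eq_square)
    ultimately show "(m + cnj m * cnj p) * (m + cnj m * cnj s) - cnj m * cnj q * (cnj m * cnj r) \<noteq> 0"
      using m(2) by simp
    have "(m + cnj m * cnj p) * p + cnj m * cnj q * r = m * p + cnj m * cnj (p * cnj p + q * cnj r)"
      by (simp add: algebra_simps)
    then show "cnj (m + cnj m * cnj p) = (m + cnj m * cnj p) * p + cnj m * cnj q * r"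
      using cocycle(1) by (simp add: algebra_simps)
    have "(m + cnj m * cnj p) * q + cnj m * cnj q * s = m * q + cnj m * cnj (p * cnj q + q * cnj s)"
      by (simp add: algebra_simps)
    then show "cnj (cnj m * cnj q) = (m + cnj m * cnj p) * q + cnj m * cnj q * s"
      using cocycle(2) by (simp add: algebra_simps)
    have "cnj m * cnj r * p + (m + cnj m * cnj s) * r = m * r + cnj m * cnj (r * cnj p + s * cnj r)"
      by (simp add: algebra_simps)
    then show "cnj (cnj m * cnj r) = cnj m * cnj r * p + (m + cnj m * cnj s) * r"
      using cocycle(3) by (simp add: algebra_simps)
    have "cnj m * cnj r * q + (m + cnj m * cnj s) * s = m * s + cnj m * cnj (r * cnj q + s * cnj s)"
      by (simp add: algebra_simps)
    then show "cnj (m + cnj m * cnj s) = cnj m * cnj r * q + (m + cnj m * cnj s) * s"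
      using cocycle(4) by (simp add: algebra_simps)
  qed
  show thesis
  proof (cases "2 + (cnj p + cnj s) = 0")
    case False
    then show thesis
      using B[of 1] subfield_closed(2)[OF sub] by (simp add: algebra_simps)
  next
    case True
    then have "cnj p + cnj s = - 2"
      by (simp add: add_eq_0_iff)
    moreover have "\<i> \<in> K"
      using alg_closed_subfield_sqrt[OF K, of \<i>] subfield_closed(2,5)[OF sub] by simp
    ultimately show thesis
      using B[of \<i>] by simp
  qed
qed

section \<open>Descent of real rational maps\<close>

theorem theorem12:
  fixes \<Q> :: "complex set" and \<phi> :: "riemann_sphere \<Rightarrow> riemann_sphere"
  assumes "alg_closed_subfield \<Q>"
    and "conjugate_invariant \<Q>"
    and "real_rational_map \<phi>"
    and "definable_over \<phi> \<Q>"
  shows "definable_over \<phi> (\<real> \<inter> \<Q>)"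
proof -
  have sub: "complex_subfield \<Q>"
    using assms(1) by (simp add: alg_closed_subfield_def)
  obtain R where R: "rational_map_over \<real> R" "equivalent \<phi> R"
    using assms(3) by (auto simp: real_rational_map_def definable_over_def)
  obtain S where S: "rational_map_over \<Q> S" "equivalent \<phi> S"
    using assms(4) by (auto simp: definable_over_def)
  obtain a b c d where det: "a * d - b * c = 1" and RT: "R \<circ> moebius a b c d = moebius a b c d \<circ> S"
    using equivalent_common_source[OF S(2) R(2)] by (auto simp: equivalent_iff)
  have cdet: "cnj a * cnj d - cnj b * cnj c = 1"
    using arg_cong[OF det, of cnj] by simp
  \<comment> \<open>\<open>A = inv T (cnj T)\<close>, so that \<open>\<sigma>\<close> is complex conjugation transported along \<open>T\<close>.\<close>
  define p q r s where "p = d * cnj a - b * cnj c" and "q = d * cnj b - b * cnj d"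
    and "r = a * cnj c - c * cnj a" and "s = a * cnj d - c * cnj b"
  define T where "T = moebius a b c d"
  define A where "A = moebius p q r s"
  define \<sigma> where "\<sigma> = A \<circ> conj_sphere"
  have det0: "a * d - b * c \<noteq> 0" "cnj a * cnj d - cnj b * cnj c \<noteq> 0"
    using det cdet by simp_all
  have "p * s - q * r = (a * d - b * c) * (cnj a * cnj d - cnj b * cnj c)"
    by (simp add: p_def q_def r_def s_def algebra_simps)
  then have detA: "p * s - q * r = 1"
    by (simp add: det cdet)
  then have detA0: "p * s - q * r \<noteq> 0"
    by simp
  have TA: "a * p + b * r = (a * d - b * c) * cnj a" "a * q + b * s = (a * d - b * c) * cnj b"
    "c * p + d * r = (a * d - b * c) * cnj c" "c * q + d * s = (a * d - b * c) * cnj d"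
    by (simp_all add: p_def q_def r_def s_def algebra_simps)
  have "T \<circ> A = moebius (cnj a) (cnj b) (cnj c) (cnj d)"
    unfolding T_def A_def moebius_comp[OF det0(1) detA0] TA det by simp
  then have T\<sigma>: "T (\<sigma> x) = conj_sphere (T x)" for x
    using conj_sphere_moebius[OF det0(1)] by (simp add: T_def \<sigma>_def fun_eq_iff)
  have inj_T: "x = y" if "T x = T y" for x y
    using that moebius_inverse_comp(1)[OF det0(1)] unfolding T_def fun_eq_iff comp_def id_def by metis
  have RT': "R (T x) = T (S x)" for x
    using RT by (simp add: T_def fun_eq_iff)
  have R_conj: "R (conj_sphere x) = conj_sphere (R x)" for x
    using rational_map_over_reals_commutes[OF R(1)] by (simp add: fun_eq_iff)
  have S\<sigma>: "S (\<sigma> x) = \<sigma> (S x)" for x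
    by (rule inj_T) (metis RT' T\<sigma> R_conj)
  then have comm: "S \<circ> \<sigma> = \<sigma> \<circ> S"
    by (simp add: fun_eq_iff)
  have "rational_map S"
    using S(1) rational_map_over_mono by blast
  then obtain x y z where xyz: "x \<in> prefixed S" "y \<in> prefixed S" "z \<in> prefixed S"
      "x \<noteq> y" "y \<noteq> z" "x \<noteq> z"
    using three_prefixed_points by blast
  \<comment> \<open>\<open>\<sigma>\<close> permutes the prefixed points of \<open>S\<close>, all of which are defined over \<open>\<Q>\<close>.\<close>
  have in_K: "conj_sphere w \<in> sphere_over \<Q>" "A (conj_sphere w) \<in> sphere_over \<Q>"
    if "w \<in> prefixed S" for w
    using that prefixed_commute[OF comm that] prefixed_in_sphere_over[OF assms(1) S(1)]
      conj_sphere_sphere_over[OF assms(2)] by (simp_all add: \<sigma>_def)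
  have inj_conj: "conj_sphere v \<noteq> conj_sphere w" if "v \<noteq> w" for v w
    using that conj_sphere_involution by metis
  have pqrs: "p \<in> \<Q>" "q \<in> \<Q>" "r \<in> \<Q>" "s \<in> \<Q>"
    using moebius_over_if_three_points[OF assms(1) detA, of "conj_sphere x" "conj_sphere y" "conj_sphere z"]
      in_K xyz inj_conj by (simp_all add: A_def)
  \<comment> \<open>The cocycle condition \<open>A (cnj A) = 1\<close>, entry by entry.\<close>
  have "p * cnj p + q * cnj r = (a * d - b * c) * (cnj a * cnj d - cnj b * cnj c)"
    "r * cnj q + s * cnj s = (a * d - b * c) * (cnj a * cnj d - cnj b * cnj c)"
    by (simp_all add: p_def q_def r_def s_def algebra_simps)
  then have diag: "p * cnj p + q * cnj r = 1" "r * cnj q + s * cnj s = 1"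
    by (simp_all add: det cdet)
  have off_diag: "p * cnj q + q * cnj s = 0" "r * cnj p + s * cnj r = 0"
    by (simp_all add: p_def q_def r_def s_def algebra_simps)
  obtain e f g h where efgh: "e \<in> \<Q>" "f \<in> \<Q>" "g \<in> \<Q>" "h \<in> \<Q>" and detB: "e * h - f * g \<noteq> 0"
    and BA: "cnj e = e * p + f * r" "cnj f = e * q + f * s"
      "cnj g = g * p + h * r" "cnj h = g * q + h * s"
    using cocycle_split[OF assms(1,2) pqrs detA diag(1) off_diag diag(2)] by blast
  define B where "B = moebius e f g h"
  define B' where "B' = moebius h (- f) (- g) e"
  have B'B: "B' (B x) = x" "B (B' x) = x" for x
    using moebius_inverse_comp[OF detB] by (simp_all add: B_def B'_def fun_eq_iff)
  \<comment> \<open>\<open>B\<close> carries \<open>\<sigma>\<close> to complex conjugation, as \<open>T\<close> does, but its entries lie in \<open>\<Q>\<close>.\<close>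
  have "B \<circ> A = moebius (cnj e) (cnj f) (cnj g) (cnj h)"
    unfolding B_def A_def moebius_comp[OF detB detA0] BA ..
  then have B\<sigma>: "B (\<sigma> x) = conj_sphere (B x)" for x
    using conj_sphere_moebius[OF detB] by (simp add: B_def \<sigma>_def fun_eq_iff)
  define \<psi> where "\<psi> = B \<circ> S \<circ> B'"
  have "\<psi> (conj_sphere x) = conj_sphere (\<psi> x)" for x
    using B\<sigma> S\<sigma> B'B unfolding \<psi>_def comp_def by metis
  then have "\<psi> \<circ> conj_sphere = conj_sphere \<circ> \<psi>"
    by (simp add: fun_eq_iff)
  moreover have "rational_map_over \<Q> \<psi>"
    unfolding \<psi>_def B_def B'_def by (rule rational_map_over_conjugate[OF sub S(1) efgh detB])
  ultimately have \<psi>: "rational_map_over (\<real> \<inter> \<Q>) \<psi>"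
    using rational_map_over_reals_if_commutes[OF sub] by blast
  have "\<psi> \<circ> moebius e f g h = moebius e f g h \<circ> S"
    using B'B by (simp add: \<psi>_def fun_eq_iff flip: B_def)
  then have "equivalent S \<psi>"
    by (rule equivalent_if_moebius_conjugate[OF detB])
  then have "equivalent \<phi> \<psi>"
    using equivalent_common_source[OF equivalent_sym[OF S(2)]] by blast
  then show ?thesis
    unfolding definable_over_def using \<psi> by blast
qed

end
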